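(* Let $a<b$ be real numbers and let $f:[a,b]\to\mathbb{R}$ be a continuous function with $f(x)\ge0$ for all $x\in[a,b]$. Let $A:[a,b]\times[a,b]\to\mathbb{R}$ be a function satisfying: (a) $A(x,y)+A(y,z)=A(x,z)$ for all $x,y,z\in[a,b]$; (b) $A(x,x+h)=\pm R(x,x+h)+o(h)$ as $h\to0_\pm$ for all $x\in[a,b]$, where $R(x,x+h)$ denotes the area of the rectangle with vertices $(x,0)$, $(x+h,0)$, $(x+h,f(x))$ and $(x,f(x))$. Then $$A(a,b)=\int_a^b f(x)\,dx.$$ Consequently, the number $A(a,b)$ (the area under the curve $y=f(x)$ and above $[a,b]$) is uniquely determined by properties (a) and (b).
   Context: In (b), the sign $+$ is taken as $h\to0_+$ and the sign $-$ as $h\to0_-$; $h\neq0$ ranges over values with $x+h\in[a,b]$ (so at $x=a$ and $x=b$ only one of the two one-sided conditions applies), and $o(h)$ denotes a quantity whose quotient by $h$ tends to $0$. The area of the rectangle is the elementary Euclidean (nonnegative) area, i.e. $R(x,x+h)=f(x)|h|$. The integral is defined axiomatically: for a continuous $\rho:[a,b]\to\mathbb{R}$, $\int_a^b\rho(x)\,dx:=I(a,b)$, where $I:[a,b]\times[a,b]\to\mathbb{R}$ is the unique function with $I(x,y)+I(y,z)=I(x,z)$ for all $x,y,z\in[a,b]$ and $I(x,x+h)=\rho(x)h+o(h)$ as $h\to0$ for all $x\in[a,b]$; this coincides with the usual Riemann integral of $\rho$. *)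

theory Defs
  imports "HOL-Analysis.Analysis"
begin

definition additive_on :: "real \<Rightarrow> real \<Rightarrow> (real \<Rightarrow> real \<Rightarrow> real) \<Rightarrow> bool" where
  "additive_on a b A \<longleftrightarrow>
     (\<forall>x\<in>{a..b}. \<forall>y\<in>{a..b}. \<forall>z\<in>{a..b}. A x y + A y z = A x z)"

definition rect_area :: "(real \<Rightarrow> real) \<Rightarrow> real \<Rightarrow> real \<Rightarrow> real" where
  "rect_area f x h =
     measure lborel (convex hull {(x, 0), (x + h, 0), (x + h, f x), (x, f x)})"

text \<open>
  The expression \<open>u h = o(h)\<close> is rendered as \<open>u h / h\<close> tending to \<open>0\<close>. At an end point of the
  interval one of the two filters below is trivial, so that only one condition remains there.
\<close>

definition area_function :: "real \<Rightarrow> real \<Rightarrow> (real \<Rightarrow> real) \<Rightarrow> (real \<Rightarrow> real \<Rightarrow> real) \<Rightarrow> bool" where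
  "area_function a b f A \<longleftrightarrow>
     additive_on a b A \<and>
     (\<forall>x\<in>{a..b}.
        ((\<lambda>h. (A x (x + h) - rect_area f x h) / h) \<longlongrightarrow> 0) (at 0 within {h. 0 < h \<and> x + h \<in> {a..b}}) \<and>
        ((\<lambda>h. (A x (x + h) - (- rect_area f x h)) / h) \<longlongrightarrow> 0) (at 0 within {h. h < 0 \<and> x + h \<in> {a..b}}))"

definition integral_function :: "real \<Rightarrow> real \<Rightarrow> (real \<Rightarrow> real) \<Rightarrow> (real \<Rightarrow> real \<Rightarrow> real) \<Rightarrow> bool" where
  "integral_function a b \<rho> I \<longleftrightarrow>
     additive_on a b I \<and>
     (\<forall>x\<in>{a..b}. ((\<lambda>h. (I x (x + h) - \<rho> x * h) / h) \<longlongrightarrow> 0) (at 0 within {h. x + h \<in> {a..b}}))"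

text \<open>
  The integral is the value at \<open>(a, b)\<close> of the unique integral function on \<open>[a,b] \<times> [a,b]\<close>.
  Functions on this square are represented by total functions that are extensional on it;
  otherwise uniqueness would fail for the irrelevant values outside the square.
  The lemmas at the end show that the description is well defined for continuous integrands, and
  that it agrees with the integral of the library.
\<close>

definition axiomatic_integral :: "real \<Rightarrow> real \<Rightarrow> (real \<Rightarrow> real) \<Rightarrow> real" where
  "axiomatic_integral a b \<rho> =
     (THE I. I \<in> extensional ({a..b} \<times> {a..b}) \<and> integral_function a b \<rho> (curry I)) (a, b)"

lemma rect_area_eq:
  assumes "0 \<le> f x"
  shows "rect_area f x h = f x * \<bar>h\<bar>"
proof -
  have seg: "convex hull {x, x + h} = {min x (x + h)..max x (x + h)}"
    by (auto simp: segment_convex_hull[symmetric] closed_segment_eq_real_ivl min_def max_def)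
  have seg': "convex hull {0, f x} = {0..f x}"
    using assms by (simp add: segment_convex_hull[symmetric] closed_segment_eq_real_ivl)
  have "{(x, 0), (x + h, 0), (x + h, f x), (x, f x)} = {x, x + h} \<times> {0, f x}"
    by auto
  then have "convex hull {(x, 0), (x + h, 0), (x + h, f x), (x, f x)}
      = {min x (x + h)..max x (x + h)} \<times> {0..f x}"
    by (simp only: convex_hull_Times seg seg')
  also have "\<dots> = cbox (min x (x + h), 0) (max x (x + h), f x)"
    by (simp add: cbox_Pair_eq)
  finally have "rect_area f x h = measure lborel (cbox (min x (x + h), 0) (max x (x + h), f x))"
    by (simp add: rect_area_def)
  also have "\<dots> = measure lborel (cbox (min x (x + h)) (max x (x + h))) * measure lborel (cbox 0 (f x))"
    by (rule content_Pair)
  also have "\<dots> = f x * \<bar>h\<bar>"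
    using assms by (auto simp: min_def max_def)
  finally show ?thesis .
qed

lemma quotient_tendsto_iff_derivative:
  fixes F :: "real \<Rightarrow> real"
  shows "((\<lambda>h. (F (x + h) - F x - d * h) / h) \<longlongrightarrow> 0) (at 0 within {h. x + h \<in> S})
      \<longleftrightarrow> (F has_real_derivative d) (at x within S)"
proof -
  have "((\<lambda>h. (F (x + h) - F x - d * h) / h) \<longlongrightarrow> 0) (at 0 within {h. x + h \<in> S})
      \<longleftrightarrow> ((\<lambda>h. (F (x + h) - F x) / h - d) \<longlongrightarrow> 0) (at 0 within {h. x + h \<in> S})"
    by (rule Lim_cong_within) (auto simp: divide_simps)
  also have "\<dots> \<longleftrightarrow> ((\<lambda>h. (F (x + h) - F x) / h) \<longlongrightarrow> d) (at 0 within {h. x + h \<in> S})"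
    by (rule LIM_zero_iff)
  also have "\<dots> \<longleftrightarrow> ((\<lambda>y. (F y - F x) / (y - x)) \<longlongrightarrow> d) (at x within S)"
  proof -
    have ev: "eventually P (at x within S)
        \<longleftrightarrow> eventually (\<lambda>h. P (x + h)) (at 0 within {h. x + h \<in> S})" for P
    proof -
      have "(\<forall>y\<in>S. y \<noteq> x \<and> dist y x < e \<longrightarrow> P y)
          \<longleftrightarrow> (\<forall>h\<in>{h. x + h \<in> S}. h \<noteq> 0 \<and> dist h 0 < e \<longrightarrow> P (x + h))" for e
      proof (intro iffI ballI impI)
        fix h assume "\<forall>y\<in>S. y \<noteq> x \<and> dist y x < e \<longrightarrow> P y" "h \<in> {h. x + h \<in> S}"
          "h \<noteq> 0 \<and> dist h 0 < e"
        then show "P (x + h)"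
          by (simp add: dist_real_def)
      next
        fix y assume *: "\<forall>h\<in>{h. x + h \<in> S}. h \<noteq> 0 \<and> dist h 0 < e \<longrightarrow> P (x + h)"
          and y: "y \<in> S" "y \<noteq> x \<and> dist y x < e"
        then show "P y"
          using bspec[OF *, of "y - x"] by (simp add: dist_real_def)
      qed
      then show ?thesis
        by (simp add: eventually_at)
    qed
    show ?thesis
      by (simp add: tendsto_def ev)
  qed
  finally show ?thesis
    by (simp add: has_field_derivative_iff)
qed

lemma integral_function_integral:
  assumes "continuous_on {a..b} \<rho>"
  shows "integral_function a b \<rho> (\<lambda>x y. integral {a..y} \<rho> - integral {a..x} \<rho>)"
  using integral_has_real_derivative[OF assms]
    quotient_tendsto_iff_derivative[where F = "\<lambda>y. integral {a..y} \<rho>" and S = "{a..b}"]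
  by (simp add: integral_function_def additive_on_def)

lemma integral_function_unique:
  assumes I: "integral_function a b \<rho> I" and x: "x \<in> {a..b}" and y: "y \<in> {a..b}"
  shows "I x y = integral {a..y} \<rho> - integral {a..x} \<rho>"
proof -
  have add: "I u v + I v w = I u w" if "u \<in> {a..b}" "v \<in> {a..b}" "w \<in> {a..b}" for u v w
    using I that by (auto simp: integral_function_def additive_on_def)
  have a: "a \<in> {a..b}"
    using x by auto
  have "(I a has_real_derivative \<rho> u) (at u within {a..b})" if u: "u \<in> {a..b}" for u
  proof -
    have "((\<lambda>h. (I u (u + h) - \<rho> u * h) / h) \<longlongrightarrow> 0) (at 0 within {h. u + h \<in> {a..b}})"
      using I u by (auto simp: integral_function_def)
    also have "?this \<longleftrightarrow> ((\<lambda>h. (I a (u + h) - I a u - \<rho> u * h) / h) \<longlongrightarrow> 0)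
        (at 0 within {h. u + h \<in> {a..b}})"
    proof (rule Lim_cong_within)
      fix h assume "h \<in> {h. u + h \<in> {a..b}}"
      then show "(I u (u + h) - \<rho> u * h) / h = (I a (u + h) - I a u - \<rho> u * h) / h"
        using add[OF a u, of "u + h"] by (simp add: algebra_simps)
    qed auto
    finally show ?thesis
      by (simp only: quotient_tendsto_iff_derivative)
  qed
  then have vec: "(I a has_vector_derivative \<rho> u) (at u within {a..v})"
    if "u \<in> {a..v}" "v \<in> {a..b}" for u v
    using that has_vector_derivative_within_subset[of "I a" "\<rho> u" u "{a..b}" "{a..v}"]
    by (auto simp: has_real_derivative_iff_has_vector_derivative)
  have int: "integral {a..v} \<rho> = I a v - I a a" if "v \<in> {a..b}" for v
    using that vec
    by (intro integral_unique fundamental_theorem_of_calculus) auto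
  show ?thesis
    using add[OF a x y] int[OF x] int[OF y] by simp
qed

lemma ex1_integral_function:
  assumes "continuous_on {a..b} \<rho>"
  shows "\<exists>!I. I \<in> extensional ({a..b} \<times> {a..b}) \<and> integral_function a b \<rho> (curry I)"
proof (rule ex_ex1I)
  let ?I = "restrict (\<lambda>(x, y). integral {a..y} \<rho> - integral {a..x} \<rho>) ({a..b} \<times> {a..b})"
  have "integral_function a b \<rho> (curry ?I)"
  proof -
    have "((\<lambda>h. (curry ?I x (x + h) - \<rho> x * h) / h) \<longlongrightarrow> 0) (at 0 within {h. x + h \<in> {a..b}})
      \<longleftrightarrow> ((\<lambda>h. (integral {a..x + h} \<rho> - integral {a..x} \<rho> - \<rho> x * h) / h) \<longlongrightarrow> 0)
          (at 0 within {h. x + h \<in> {a..b}})" if "x \<in> {a..b}" for x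
      by (rule Lim_cong_within) (use that in auto)
    then show ?thesis
      using integral_function_integral[OF assms]
      by (auto simp: integral_function_def additive_on_def)
  qed
  then show "\<exists>I. I \<in> extensional ({a..b} \<times> {a..b}) \<and> integral_function a b \<rho> (curry I)"
    by (intro exI[of _ ?I]) auto
next
  fix I J
  assume I: "I \<in> extensional ({a..b} \<times> {a..b}) \<and> integral_function a b \<rho> (curry I)"
    and J: "J \<in> extensional ({a..b} \<times> {a..b}) \<and> integral_function a b \<rho> (curry J)"
  show "I = J"
  proof (rule extensionalityI)
    fix p assume "p \<in> {a..b} \<times> {a..b}"
    then show "I p = J p"
      using integral_function_unique[of a b \<rho> "curry I"] integral_function_unique[of a b \<rho> "curry J"] I J
      by (cases p) auto
  qed (use I J in auto)
qed

lemma axiomatic_integral_eq_integral: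
  assumes "a \<le> b" and "continuous_on {a..b} \<rho>"
  shows "axiomatic_integral a b \<rho> = integral {a..b} \<rho>"
proof -
  let ?I = "THE I. I \<in> extensional ({a..b} \<times> {a..b}) \<and> integral_function a b \<rho> (curry I)"
  have "integral_function a b \<rho> (curry ?I)"
    using theI'[OF ex1_integral_function[OF assms(2)]] by blast
  from integral_function_unique[OF this, of a b] show ?thesis
    using assms(1) by (simp add: axiomatic_integral_def)
qed

end

theory Submission
  imports Defs
begin

text \<open>The filter \<open>at c within S\<close> ignores the point \<open>c\<close> itself, so
  removing \<open>c\<close> from the set changes nothing. This allows a limit at \<open>c\<close> to
  be glued from its two one-sided limits.\<close>

lemma at_within_split_sides:
  fixes c :: real
  shows "at c within {h. P h} = sup (at c within {h. c < h \<and> P h}) (at c within {h. h < c \<and> P h})"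
proof -
  have "{h. P h} - {c} = ({h. c < h \<and> P h} \<union> {h. h < c \<and> P h}) - {c}"
    by auto
  then have "at c within {h. P h} = at c within ({h. c < h \<and> P h} \<union> {h. h < c \<and> P h})"
    by (simp only: at_within_def)
  then show ?thesis
    by (simp only: at_within_union)
qed

text \<open>
  The signs in the one-sided conditions turn the unsigned area \<open>f x * \<bar>h\<bar>\<close> into \<open>f x * h\<close>, so that
  an area function is an integral function in the sense of the axiomatic integral.
\<close>

lemma area_function_imp_integral_function:
  assumes nonneg: "\<And>x. x \<in> {a..b} \<Longrightarrow> 0 \<le> f x" and A: "area_function a b f A"
  shows "integral_function a b f A"
proof -
  have "((\<lambda>h. (A x (x + h) - f x * h) / h) \<longlongrightarrow> 0) (at 0 within {h. x + h \<in> {a..b}})"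
    if x: "x \<in> {a..b}" for x
  proof -
    let ?q = "\<lambda>h. (A x (x + h) - f x * h) / h"
    \<comment> \<open>On each side the two quotients agree exactly, so no error estimate is
      needed.\<close>
    have "(?q \<longlongrightarrow> 0) (at 0 within {h. 0 < h \<and> x + h \<in> {a..b}}) \<longleftrightarrow>
        ((\<lambda>h. (A x (x + h) - rect_area f x h) / h) \<longlongrightarrow> 0) (at 0 within {h. 0 < h \<and> x + h \<in> {a..b}})"
      by (rule Lim_cong_within) (simp_all add: rect_area_eq nonneg[OF x])
    moreover have "(?q \<longlongrightarrow> 0) (at 0 within {h. h < 0 \<and> x + h \<in> {a..b}}) \<longleftrightarrow>
        ((\<lambda>h. (A x (x + h) - (- rect_area f x h)) / h) \<longlongrightarrow> 0) (at 0 within {h. h < 0 \<and> x + h \<in> {a..b}})"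
      by (rule Lim_cong_within) (simp_all add: rect_area_eq nonneg[OF x])
    \<comment> \<open>The end points need no separate case: there one of the two filters is trivial
      and its limit holds vacuously.\<close>
    ultimately show ?thesis
      using A x unfolding area_function_def
      by (subst at_within_split_sides) (blast intro: filterlim_sup)
  qed
  then show ?thesis
    using A by (simp add: integral_function_def area_function_def)
qed

theorem theorem4p1:
  fixes a b :: real and f :: "real \<Rightarrow> real" and A :: "real \<Rightarrow> real \<Rightarrow> real"
  assumes "a < b"
    and "continuous_on {a..b} f"
    and "\<And>x. x \<in> {a..b} \<Longrightarrow> f x \<ge> 0"
    and "area_function a b f A"
  shows "A a b = axiomatic_integral a b f
    \<and> (\<forall>B. area_function a b f B \<longrightarrow> B a b = A a b)"
proof -
  \<comment> \<open>Keeping \<open>B\<close> arbitrary yields both the formula for \<open>A\<close>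
    and uniqueness. The subtracted term \<open>integral {a..a} f\<close> vanishes, which leaves the
    integral over the whole interval.\<close>
  have eq: "B a b = axiomatic_integral a b f" if "area_function a b f B" for B
    using integral_function_unique[OF area_function_imp_integral_function[OF assms(3) that], of a b] assms(1,2)
    by (simp add: axiomatic_integral_eq_integral)
  show ?thesis
    by (intro conjI allI impI) (simp_all only: eq assms(4))
qed

end
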